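(* Let $a<b$ be real numbers, let $p:[a,b]\to[1,+\infty)$ be Lebesgue integrable and essentially bounded, and let $f\in WBV_{p(\cdot)}[a,b]$. Then $f$ has a left-hand limit and a right-hand limit at each point of $[a,b]$, where at the end points only $f(a+)$ and $f(b-)$ are considered.
   Context: For a nondegenerate closed interval $Q=[s,t]\subset[a,b]$ put $f(Q):=f(t)-f(s)$, $|Q|=t-s$, and $\bar p(Q):=\left(\frac{1}{|Q|}\int_Q\frac{1}{p(x)}\,dx\right)^{-1}$. A finite partition of $[a,b]$ is a family $P=\{Q_k\}_{k=1}^n$ with $Q_k=[t_{k-1},t_k]$ and $a=t_0<\dots<t_n=b$; $\Pi[a,b]$ is the set of all finite partitions. Define $$V_a^b(p,f):=\sup_{P\in\Pi[a,b]}\sum_{k=1}^n|f(Q_k)|^{\bar p(Q_k)}\in[0,+\infty],$$ $$\|f\|_{WBV_{p(\cdot)}}:=\inf\{\lambda>0: V_a^b(p,f/\lambda)\le 1\}\quad(\inf\emptyset=+\infty),$$ $$WBV_{p(\cdot)}[a,b]:=\{f:[a,b]\to\mathbb{R}: f(a)=0,\ \|f\|_{WBV_{p(\cdot)}}<+\infty\}.$$ The symbols $f(x-)$ and $f(x+)$ denote the (finite) left-hand and right-hand limits of $f$ at $x$. *)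

theory Defs
  imports "HOL-Analysis.Analysis"
begin

(* Functions on [a,b] are total functions on the reals; only their values on [a,b] are used.
   A closed interval Q = [s,t] is given by its end points s < t. *)

definition increment :: "(real \<Rightarrow> real) \<Rightarrow> real \<Rightarrow> real \<Rightarrow> real" where
  "increment f s t = f t - f s"

definition mean_exponent :: "(real \<Rightarrow> real) \<Rightarrow> real \<Rightarrow> real \<Rightarrow> real" where
  "mean_exponent p s t = inverse (1 / (t - s) * (LINT x:{s..t}|lebesgue. 1 / p x))"

(* A pair (n, t) stands for the partition into [t 0, t 1], ..., [t (n - 1), t n];
   the values of t beyond n are irrelevant. *)
definition partitions :: "real \<Rightarrow> real \<Rightarrow> (nat \<times> (nat \<Rightarrow> real)) set" where
  "partitions a b = {(n, t). t 0 = a \<and> t n = b \<and> (\<forall>k<n. t k < t (Suc k))}"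

definition wiener_variation ::
  "real \<Rightarrow> real \<Rightarrow> (real \<Rightarrow> real) \<Rightarrow> (real \<Rightarrow> real) \<Rightarrow> ennreal" where
  "wiener_variation a b p f =
     (SUP (n, t) \<in> partitions a b.
        ennreal (\<Sum>k<n. \<bar>increment f (t k) (t (Suc k))\<bar>
                         powr mean_exponent p (t k) (t (Suc k))))"

(* In ennreal the infimum of the empty set is \<infinity>. *)
definition WBV_norm ::
  "real \<Rightarrow> real \<Rightarrow> (real \<Rightarrow> real) \<Rightarrow> (real \<Rightarrow> real) \<Rightarrow> ennreal" where
  "WBV_norm a b p f =
     Inf {ennreal c | c. 0 < c \<and> wiener_variation a b p (\<lambda>x. f x / c) \<le> 1}"

definition WBV :: "real \<Rightarrow> real \<Rightarrow> (real \<Rightarrow> real) \<Rightarrow> (real \<Rightarrow> real) set" where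
  "WBV a b p = {f. f a = 0 \<and> WBV_norm a b p f < \<infinity>}"

definition essentially_bounded_on :: "real set \<Rightarrow> (real \<Rightarrow> real) \<Rightarrow> bool" where
  "essentially_bounded_on S p \<longleftrightarrow> (\<exists>M. AE x in lebesgue_on S. \<bar>p x\<bar> \<le> M)"

end

theory Submission
  imports Defs
begin

text \<open>
  The idea is to trade \<open>f\<close> for a monotone function that controls it, as one does with the total
  variation of a function of bounded variation. The finite norm yields a scaling \<open>g = f / c\<close>
  whose variation over the whole interval is at most 1. Let \<open>w t\<close> be the variation of \<open>g\<close> over
  the interval from \<open>a\<close> to \<open>t\<close>. Appending \<open>t\<close> to a partition that ends at \<open>s < t\<close> gives
  (lemma \<open>wiener_variation_append\<close>)
  \<open>w s + \<bar>g t - g s\<bar> powr mean_exponent p s t \<le> w t\<close>.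
  Hence \<open>w\<close> is increasing with values between 0 and 1, and so it has one-sided limits.

  These limits pass from \<open>w\<close> to \<open>g\<close> because the exponents stay below one constant \<open>M\<close>
  (lemma \<open>mean_exponent_bounded\<close>, where essential boundedness enters): for
  \<open>0 < \<eta> \<le> 1\<close>, a jump \<open>\<bar>g t - g s\<bar> \<ge> \<eta>\<close> costs at least \<open>\<eta> powr M\<close>, whatever the length
  and position of the interval. So small increments of \<open>w\<close> force small increments of \<open>g\<close>, uniformly,
  and the Cauchy criterion (lemma \<open>tendsto_if_oscillation_controlled\<close>) applies to \<open>g\<close> on each
  side of a point.
\<close>

text \<open>
  The mean exponent is a harmonic mean of \<open>p\<close>: almost everywhere \<open>1 / p \<ge> 1 / M\<close>, so the average of
  \<open>1 / p\<close> over any subinterval is at least \<open>1 / M\<close>.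
\<close>
lemma mean_exponent_bounded:
  fixes a b :: real and p :: "real \<Rightarrow> real"
  assumes p1: "\<And>x. x \<in> {a..b} \<Longrightarrow> 1 \<le> p x"
    and pint: "integrable (lebesgue_on {a..b}) p"
    and pb: "essentially_bounded_on {a..b} p"
  obtains M where "\<And>s t. a \<le> s \<Longrightarrow> s < t \<Longrightarrow> t \<le> b \<Longrightarrow>
           0 \<le> mean_exponent p s t \<and> mean_exponent p s t \<le> M"
proof -
  obtain M0 where M0: "AE x in lebesgue_on {a..b}. \<bar>p x\<bar> \<le> M0"
    using pb unfolding essentially_bounded_on_def by blast
  define M where "M = max 1 M0"
  have M1: "1 \<le> M" by (simp add: M_def)
  have AE_M: "AE x in lebesgue. x \<in> {a..b} \<longrightarrow> p x \<le> M"
    using M0 by (subst (asm) AE_restrict_space_iff) (auto simp: M_def elim!: eventually_mono)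
  have integrable_inverse: "set_integrable lebesgue {a..b} (\<lambda>x. 1 / p x)"
  proof -
    have "integrable (lebesgue_on {a..b}) (\<lambda>x. 1 / p x)"
    proof (rule Bochner_Integration.integrable_bound[OF pint])
      show "(\<lambda>x. 1 / p x) \<in> borel_measurable (lebesgue_on {a..b})"
        using pint by measurable
      show "AE x in lebesgue_on {a..b}. norm (1 / p x) \<le> norm (p x)"
      proof (rule AE_I2)
        fix x assume "x \<in> space (lebesgue_on {a..b})"
        then have "1 \<le> p x" using p1 by simp
        moreover from this have "1 * 1 \<le> p x * p x" by (intro mult_mono) auto
        ultimately show "norm (1 / p x) \<le> norm (p x)" by (simp add: divide_simps)
      qed
    qed
    then show ?thesis
      by (simp add: set_integrable_def integrable_restrict_space)
  qed
  have "0 \<le> mean_exponent p s t \<and> mean_exponent p s t \<le> M"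
    if st: "a \<le> s" "s < t" "t \<le> b" for s t
  proof -
    have sub: "{s..t} \<subseteq> {a..b}" using st by auto
    let ?I = "LINT x:{s..t}|lebesgue. 1 / p x"
    have "(t - s) * (1 / M) = (LINT x:{s..t}|lebesgue. 1 / M)"
      using st by (simp add: set_lebesgue_integral_def)
    also have "\<dots> \<le> ?I"
    proof (rule set_integral_mono_AE)
      show "set_integrable lebesgue {s..t} (\<lambda>x. 1 / M)"
        unfolding set_integrable_def
        by (intro integrable_scaleR_left) (auto simp flip: lmeasurable_iff_integrable)
      show "set_integrable lebesgue {s..t} (\<lambda>x. 1 / p x)"
        using set_integrable_subset[OF integrable_inverse _ sub] by simp
      show "AE x\<in>{s..t} in lebesgue. 1 / M \<le> 1 / p x"
        using AE_M
      proof eventually_elim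
        case (elim x)
        show ?case
        proof
          assume "x \<in> {s..t}"
          then have "x \<in> {a..b}" using sub by blast
          then show "1 / M \<le> 1 / p x" using elim p1[of x] by (intro divide_left_mono) auto
        qed
      qed
    qed
    finally have I: "1 / M \<le> 1 / (t - s) * ?I"
      using st by (simp add: field_simps)
    have "inverse (1 / (t - s) * ?I) \<le> inverse (1 / M)"
      using I M1 by (intro le_imp_inverse_le) auto
    moreover have "0 \<le> 1 / (t - s) * ?I"
      using I M1 by (smt (verit) zero_le_divide_1_iff)
    ultimately show ?thesis
      unfolding mean_exponent_def by (simp only: inverse_nonnegative_iff_nonnegative inverse_eq_divide[of "1 / M"] div_by_1 divide_divide_eq_right mult_1 simp_thms)
  qed
  with that show ?thesis by blast
qed

text \<open>
  Superadditivity of the variation when a single interval is adjoined on the right. It gives at once that the variation is increasing in its right end point and that each of its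
  increments dominates the corresponding power of the jump of \<open>g\<close>.
\<close>
lemma wiener_variation_append:
  assumes "a \<le> s" "s < t"
  shows "wiener_variation a s p g + ennreal (\<bar>g t - g s\<bar> powr mean_exponent p s t)
           \<le> wiener_variation a t p g"
proof -
  \<comment> \<open>For \<open>a = s\<close> the partition into no intervals is the only one, and its sum is 0.\<close>
  have "((if a = s then 0 else 1), (\<lambda>k. if k = 0 then a else s)) \<in> partitions a s"
    using assms(1) by (auto simp: partitions_def)
  then have nonempty: "partitions a s \<noteq> {}" by blast
  let ?J = "\<bar>g t - g s\<bar> powr mean_exponent p s t"
  let ?S = "\<lambda>n \<tau>. \<Sum>k<n. \<bar>increment g (\<tau> k) (\<tau> (Suc k))\<bar> powr mean_exponent p (\<tau> k) (\<tau> (Suc k))"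
  have step: "ennreal (?S n \<tau>) + ennreal ?J \<le> wiener_variation a t p g"
    if P: "(n, \<tau>) \<in> partitions a s" for n \<tau>
  proof -
    define \<tau>' where "\<tau>' = \<tau>(Suc n := t)"
    have P': "(Suc n, \<tau>') \<in> partitions a t"
      using P assms(2) by (auto simp: partitions_def \<tau>'_def less_Suc_eq)
    have "?S n \<tau>' = ?S n \<tau>"
      by (rule sum.cong) (auto simp: \<tau>'_def)
    moreover have "\<tau> n = s" using P by (simp add: partitions_def)
    ultimately have "?S (Suc n) \<tau>' = ?S n \<tau> + ?J"
      by (simp add: \<tau>'_def increment_def)
    then have "ennreal (?S n \<tau>) + ennreal ?J = ennreal (?S (Suc n) \<tau>')"
      by (simp add: ennreal_plus sum_nonneg)
    also have "\<dots> \<le> wiener_variation a t p g"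
      unfolding wiener_variation_def using P' by (intro SUP_upper2[OF P']) auto
    finally show ?thesis .
  qed
  have "wiener_variation a s p g + ennreal ?J
      = (SUP (n, \<tau>) \<in> partitions a s. ennreal (?S n \<tau>) + ennreal ?J)"
    unfolding wiener_variation_def using nonempty
    by (subst ennreal_SUP_add_left[symmetric]) (auto simp: case_prod_unfold)
  also have "\<dots> \<le> wiener_variation a t p g"
    using step by (auto intro!: SUP_least)
  finally show ?thesis .
qed

text \<open>
  Cauchy criterion relative to a convergent function: far along \<open>F\<close> the values of \<open>w\<close> cluster,
  hence so do those of \<open>g\<close>. Stating it for an arbitrary filter covers both one-sided limits at once.
\<close>
lemma tendsto_if_oscillation_controlled:
  fixes w g :: "'a \<Rightarrow> real"
  assumes w: "(w \<longlongrightarrow> L) F"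
    and S: "eventually (\<lambda>x. x \<in> S) F"
    and control: "\<And>\<epsilon>. \<epsilon> > 0 \<Longrightarrow>
      \<exists>\<delta>>0. \<forall>x\<in>S. \<forall>y\<in>S. \<bar>w x - w y\<bar> < \<delta> \<longrightarrow> \<bar>g x - g y\<bar> < \<epsilon>"
  shows "\<exists>l. (g \<longlongrightarrow> l) F"
proof (cases "F = bot")
  case False
  have "cauchy_filter (filtermap g F)"
    unfolding cauchy_filter_metric_filtermap
  proof (intro allI impI)
    fix \<epsilon> :: real assume "\<epsilon> > 0"
    then obtain \<delta> where \<delta>: "\<delta> > 0"
      and osc: "\<And>x y. x \<in> S \<Longrightarrow> y \<in> S \<Longrightarrow> \<bar>w x - w y\<bar> < \<delta> \<Longrightarrow> \<bar>g x - g y\<bar> < \<epsilon>"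
      using control by blast
    have "\<forall>\<^sub>F x in F. \<bar>w x - L\<bar> < \<delta> / 2"
      using tendstoD[OF w, of "\<delta> / 2"] \<delta> by (simp add: dist_real_def)
    then have "\<forall>\<^sub>F x in F. x \<in> S \<and> \<bar>w x - L\<bar> < \<delta> / 2"
      using S by eventually_elim simp
    moreover have "dist (g x) (g y) < \<epsilon>"
      if "x \<in> S \<and> \<bar>w x - L\<bar> < \<delta> / 2" "y \<in> S \<and> \<bar>w y - L\<bar> < \<delta> / 2" for x y
      unfolding dist_real_def by (rule osc) (use that in linarith)+
    ultimately show "\<exists>P. eventually P F \<and> (\<forall>x y. P x \<and> P y \<longrightarrow> dist (g x) (g y) < \<epsilon>)"
      by blast
  qed
  then obtain l where "filtermap g F \<le> nhds l"
    using cauchy_filter_complete_converges[of "filtermap g F" UNIV] False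
    by (auto simp: filtermap_bot_iff complete_UNIV)
  then show ?thesis by (auto simp: filterlim_def)
qed simp

theorem theorem2p8:
  fixes a b :: real and p f :: "real \<Rightarrow> real"
  assumes "a < b"
    and "\<And>x. x \<in> {a..b} \<Longrightarrow> 1 \<le> p x"
    and "integrable (lebesgue_on {a..b}) p"
    and "essentially_bounded_on {a..b} p"
    and "f \<in> WBV a b p"
  shows "(\<forall>x\<in>{a<..b}. \<exists>l::real. (f \<longlongrightarrow> l) (at_left x)) \<and>
         (\<forall>x\<in>{a..<b}. \<exists>l::real. (f \<longlongrightarrow> l) (at_right x))"
proof -
  obtain M where M: "\<And>s t. a \<le> s \<Longrightarrow> s < t \<Longrightarrow> t \<le> b \<Longrightarrow>
              0 \<le> mean_exponent p s t \<and> mean_exponent p s t \<le> M"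
    using mean_exponent_bounded[OF assms(2-4)] by blast
  have "WBV_norm a b p f < \<infinity>" using assms(5) by (simp add: WBV_def)
  then obtain c where c: "c > 0" "wiener_variation a b p (\<lambda>x. f x / c) \<le> 1"
    unfolding WBV_norm_def by (auto simp: Inf_less_iff)
  define g where "g = (\<lambda>x. f x / c)"
  define w where "w t = enn2real (wiener_variation a t p g)" for t
  have var_le1: "wiener_variation a t p g \<le> 1" if "a \<le> t" "t \<le> b" for t
  proof (cases "t = b")
    case False
    have "wiener_variation a t p g \<le> wiener_variation a t p g + ennreal (\<bar>g b - g t\<bar> powr mean_exponent p t b)"
      by simp
    also have "\<dots> \<le> wiener_variation a b p g"
      using that False by (intro wiener_variation_append) auto
    finally show ?thesis using c(2) by (simp add: g_def)
  qed (use c(2) in \<open>simp add: g_def\<close>)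
  have var_w: "wiener_variation a t p g = ennreal (w t)" if "a \<le> t" "t \<le> b" for t
    using var_le1[OF that] unfolding w_def
    by (metis ennreal_enn2real ennreal_one_less_top order_le_less_trans)
  have w_ge0: "0 \<le> w t" for t by (simp add: w_def)
  have w_le1: "w t \<le> 1" if "a \<le> t" "t \<le> b" for t
    using var_le1[OF that] var_w[OF that] w_ge0[of t] by simp
  have w_step: "w s + \<bar>g t - g s\<bar> powr mean_exponent p s t \<le> w t"
    if "a \<le> s" "s < t" "t \<le> b" for s t
  proof -
    have "ennreal (w s + \<bar>g t - g s\<bar> powr mean_exponent p s t) \<le> ennreal (w t)"
      using wiener_variation_append[of a s t p g] var_w[of s] var_w[of t] that w_ge0[of s]
      by (simp add: ennreal_plus)
    then show ?thesis using w_ge0[of t] by (simp add: ennreal_le_iff)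
  qed
  have w_mono: "w s \<le> w t" if "a \<le> s" "s \<le> t" "t \<le> b" for s t
  proof (cases "s = t")
    case False
    then have "w s + \<bar>g t - g s\<bar> powr mean_exponent p s t \<le> w t" using w_step that by simp
    then show ?thesis by (rule order_trans[rotated]) simp
  qed simp
  have control: "\<exists>\<delta>>0. \<forall>x\<in>{a..b}. \<forall>y\<in>{a..b}. \<bar>w x - w y\<bar> < \<delta> \<longrightarrow> \<bar>g x - g y\<bar> < \<epsilon>"
    if "\<epsilon> > 0" for \<epsilon>
  proof -
    \<comment> \<open>Below 1, powers decrease in the exponent, so \<open>\<eta> powr M\<close> bounds all \<open>\<eta> powr q\<close> with \<open>q \<le> M\<close> from below.\<close>
    define \<eta> where "\<eta> = min \<epsilon> 1"
    have \<eta>: "0 < \<eta>" "\<eta> \<le> 1" "\<eta> \<le> \<epsilon>" using that by (auto simp: \<eta>_def)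
    have jump: "\<bar>g t - g s\<bar> < \<epsilon>"
      if st: "a \<le> s" "s < t" "t \<le> b" and small: "w t - w s < \<eta> powr M" for s t
    proof (rule ccontr)
      assume "\<not> \<bar>g t - g s\<bar> < \<epsilon>"
      then have "\<eta> \<le> \<bar>g t - g s\<bar>" using \<eta> by linarith
      have "\<eta> powr M \<le> \<eta> powr mean_exponent p s t"
        using M[OF st] \<eta> by (intro powr_mono') auto
      also have "\<dots> \<le> \<bar>g t - g s\<bar> powr mean_exponent p s t"
        using M[OF st] \<eta> \<open>\<eta> \<le> \<bar>g t - g s\<bar>\<close> by (intro powr_mono2) auto
      also have "\<dots> \<le> w t - w s" using w_step[OF st] by linarith
      finally show False using small by linarith
    qed
    have "\<bar>g x - g y\<bar> < \<epsilon>"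
      if "x \<in> {a..b}" "y \<in> {a..b}" "\<bar>w x - w y\<bar> < \<eta> powr M" for x y
      using jump[of x y] jump[of y x] that \<open>\<epsilon> > 0\<close>
      by (cases x y rule: linorder_cases) (auto simp: abs_minus_commute)
    moreover have "\<eta> powr M > 0" using \<eta> by simp
    ultimately show ?thesis by blast
  qed
  have limit_f: "\<exists>l. (f \<longlongrightarrow> l) F"
    if w_lim: "(w \<longlongrightarrow> L) F" and near: "eventually (\<lambda>x. x \<in> {a..b}) F" for L F
  proof -
    obtain l where "(g \<longlongrightarrow> l) F"
      using tendsto_if_oscillation_controlled[OF w_lim near control] by blast
    then have "((\<lambda>x. c * g x) \<longlongrightarrow> c * l) F" by (intro tendsto_intros)
    moreover have "(\<lambda>x. c * g x) = f" using c(1) by (simp add: g_def)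
    ultimately show ?thesis by auto
  qed
  have "\<exists>l. (f \<longlongrightarrow> l) (at_left x)" if "x \<in> {a<..b}" for x
  proof (rule limit_f)
    have "(w \<longlongrightarrow> Sup (w ` ({..<x} \<inter> {a<..}))) (at x within ({..<x} \<inter> {a<..}))"
      by (rule Lim_left_bound[where K = 1]) (use that w_mono w_le1 in auto)
    moreover have "at x within ({..<x} \<inter> {a<..}) = at_left x"
      by (rule at_within_nhd[of x "{a<..}"]) (use that in auto)
    ultimately show "(w \<longlongrightarrow> Sup (w ` ({..<x} \<inter> {a<..}))) (at_left x)" by simp
    show "\<forall>\<^sub>F y in at_left x. y \<in> {a..b}"
      using that by (auto simp: eventually_at_left_field intro!: exI[of _ a])
  qed
  moreover have "\<exists>l. (f \<longlongrightarrow> l) (at_right x)" if "x \<in> {a..<b}" for x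
  proof (rule limit_f)
    have "(w \<longlongrightarrow> Inf (w ` ({x<..} \<inter> {..<b}))) (at x within ({x<..} \<inter> {..<b}))"
      by (rule Lim_right_bound[where K = 0]) (use that w_mono w_ge0 in auto)
    moreover have "at x within ({x<..} \<inter> {..<b}) = at_right x"
      by (rule at_within_nhd[of x "{..<b}"]) (use that in auto)
    ultimately show "(w \<longlongrightarrow> Inf (w ` ({x<..} \<inter> {..<b}))) (at_right x)" by simp
    show "\<forall>\<^sub>F y in at_right x. y \<in> {a..b}"
      using that by (auto simp: eventually_at_right_field intro!: exI[of _ b])
  qed
  ultimately show ?thesis by blast
qed

end
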